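(* Let $\{\xi_n\}_{n=0}^\infty$ be i.i.d. real random variables. Suppose: (a) $\mathcal{L}$ is local; (b) $\sup_{n\ge 0}|\xi_n|\le P_{0,0}<1$; and (c) $u_0:\mathbf{Z}^d\to\mathbf{R}$ is a non-random function with $u_0(x)\ge 0$ for all $x\in\mathbf{Z}^d$, and $0<\sum_{z\in\mathbf{Z}^d}u_0(z)<\infty$. Then the Anderson model $$u_{n+1}(x)-u_n(x)=(\mathcal{L}u_n)(x)+u_n(x)\,\xi_n\qquad (n\ge 0,\ x\in\mathbf{Z}^d)$$ with initial function $u_0$ has a unique a.s.-nonnegative solution $\mathbf{u}$, and $M_n:=\sup_{x\in\mathbf{Z}^d}u_n(x)$ satisfies $$\lim_{n\to\infty}\frac1n\ln\mathrm{E}(M_n^p)=\Gamma(p)\qquad\text{for all }p\in[0,\infty),$$ and $$\lim_{n\to\infty}\frac1n\ln M_n=\lim_{n\to\infty}\frac1n\mathrm{E}(\ln M_n)=\Gamma'(0^+)\qquad\text{almost surely},$$ where $\Gamma(p):=\ln\mathrm{E}[(1+\xi_1)^p]$ for all $p\ge 0$.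
   Context: $\mathcal{L}$ is the generator of a random walk on $\mathbf{Z}^d$: $\mathcal{L}=\mathcal{P}-\mathcal{I}$, where $\mathcal{I}$ is the identity and $(\mathcal{P}h)(x)=\sum_{y\in\mathbf{Z}^d}P_{x,y}h(y)$ with $P_{x,y}=P_{0,y-x}$ the one-step transition probabilities of the walk. $\mathcal{L}$ is local if there exists $R>0$ such that $P_{0,x}=0$ whenever $|x|>R$. $\Gamma'(0^+)$ denotes the right derivative of $\Gamma$ at $0$. The noise here depends on time only, i.e. the same $\xi_n$ is used at every site $x$. *)

theory Defs
  imports "HOL-Probability.Probability"
begin

text \<open>
  The lattice of integer points of dimension \<open>d\<close> is the type \<open>int ^ 'd\<close> with \<open>d = CARD('d)\<close>.
  Kernels \<open>P x y\<close> are one-step transition probabilities from \<open>x\<close> to \<open>y\<close>.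
\<close>

definition random_walk_kernel :: "(int ^ 'd \<Rightarrow> int ^ 'd \<Rightarrow> real) \<Rightarrow> bool" where
  "random_walk_kernel P \<longleftrightarrow>
     (\<forall>x y. 0 \<le> P x y) \<and>
     (\<forall>x. ((\<lambda>y. P x y) has_sum 1) UNIV) \<and>
     (\<forall>x y. P x y = P 0 (y - x))"

definition transition_operator ::
  "(int ^ 'd \<Rightarrow> int ^ 'd \<Rightarrow> real) \<Rightarrow> (int ^ 'd \<Rightarrow> real) \<Rightarrow> int ^ 'd \<Rightarrow> real" where
  "transition_operator P h x = (\<Sum>\<^sub>\<infinity>y. P x y * h y)"

definition generator ::
  "(int ^ 'd \<Rightarrow> int ^ 'd \<Rightarrow> real) \<Rightarrow> (int ^ 'd \<Rightarrow> real) \<Rightarrow> int ^ 'd \<Rightarrow> real" where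
  "generator P h x = transition_operator P h x - h x"

text \<open>
  The norm is the Euclidean one. Under this condition the sum in \<^const>\<open>transition_operator\<close>
  has only finitely many nonzero terms, so it is meaningful for every function \<open>h\<close>.
\<close>

definition local_kernel :: "(int ^ 'd::finite \<Rightarrow> int ^ 'd \<Rightarrow> real) \<Rightarrow> bool" where
  "local_kernel P \<longleftrightarrow>
     (\<exists>R::real. R > 0 \<and> (\<forall>x. norm (\<chi> i. real_of_int (x $ i)) > R \<longrightarrow> P 0 x = 0))"

definition iid :: "'w measure \<Rightarrow> (nat \<Rightarrow> 'w \<Rightarrow> real) \<Rightarrow> bool" where
  "iid M \<xi> \<longleftrightarrow>
     prob_space.indep_vars M (\<lambda>_. borel) \<xi> UNIV \<and>
     (\<forall>n. distr M borel (\<xi> n) = distr M borel (\<xi> 0))"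

text \<open>A solution is a random field; the equation and the initial condition hold almost surely.\<close>

definition anderson_solution ::
  "'w measure \<Rightarrow> (int ^ 'd \<Rightarrow> int ^ 'd \<Rightarrow> real) \<Rightarrow> (nat \<Rightarrow> 'w \<Rightarrow> real) \<Rightarrow> (int ^ 'd \<Rightarrow> real) \<Rightarrow>
     (nat \<Rightarrow> int ^ 'd \<Rightarrow> 'w \<Rightarrow> real) \<Rightarrow> bool" where
  "anderson_solution M P \<xi> u0 u \<longleftrightarrow>
     (\<forall>n x. u n x \<in> borel_measurable M) \<and>
     (AE \<omega> in M. \<forall>x. u 0 x \<omega> = u0 x) \<and>
     (AE \<omega> in M. \<forall>n x. u (Suc n) x \<omega> - u n x \<omega>
        = generator P (\<lambda>y. u n y \<omega>) x + u n x \<omega> * \<xi> n \<omega>)"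

definition nonneg_anderson_solution ::
  "'w measure \<Rightarrow> (int ^ 'd \<Rightarrow> int ^ 'd \<Rightarrow> real) \<Rightarrow> (nat \<Rightarrow> 'w \<Rightarrow> real) \<Rightarrow> (int ^ 'd \<Rightarrow> real) \<Rightarrow>
     (nat \<Rightarrow> int ^ 'd \<Rightarrow> 'w \<Rightarrow> real) \<Rightarrow> bool" where
  "nonneg_anderson_solution M P \<xi> u0 u \<longleftrightarrow>
     anderson_solution M P \<xi> u0 u \<and> (AE \<omega> in M. \<forall>n x. 0 \<le> u n x \<omega>)"

text \<open>
  A real supremum, hence only meaningful if \<open>u n\<close> is bounded above at \<open>\<omega>\<close>.
\<close>

definition global_sup :: "(nat \<Rightarrow> int ^ 'd \<Rightarrow> 'w \<Rightarrow> real) \<Rightarrow> nat \<Rightarrow> 'w \<Rightarrow> real" where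
  "global_sup u n \<omega> = (SUP x. u n x \<omega>)"

definition Lyapunov_Gamma :: "'w measure \<Rightarrow> (nat \<Rightarrow> 'w \<Rightarrow> real) \<Rightarrow> real \<Rightarrow> real" where
  "Lyapunov_Gamma M \<xi> p = ln (\<integral>\<omega>. (1 + \<xi> 1 \<omega>) powr p \<partial>M)"

end

theory Submission
  imports Defs
begin

text \<open>
  The noise is the same at every site and the walk conserves mass, so one step of the model
  multiplies the total mass of the field by exactly \<open>1 + \<xi> n\<close>; the total mass at time \<open>n\<close> is
  therefore \<open>S\<close> times \<open>\<Prod>j<n. 1 + \<xi> j\<close>, where \<open>S\<close> is the initial mass. The idea is that the supremum
  differs from this explicit product by at most a polynomial factor.

  The supremum of a nonnegative field is at most its total mass (\<open>driven_field_le_total_mass\<close>).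
  Conversely, since \<open>\<bar>\<xi> n\<bar> \<le> P 0 0\<close>, one step acts by a nonnegative kernel, so the evolution is
  monotone and dominates the one started from the single atom \<open>u0 z\<close> at a point with \<open>0 < u0 z\<close>. By
  locality that smaller field lives on a box with \<open>O(n ^ d)\<close> points, while its total mass is
  \<open>u0 z\<close> times the same product; its largest value is at least the average over the box
  (\<open>sup_lower_bound\<close>). Hence the logarithm of the supremum lies within a deterministic \<open>O(ln n)\<close>
  of the random walk \<open>\<Sum>j<n. ln (1 + \<xi> j)\<close> (\<open>log_sup_near_log_product\<close>).

  The summands \<open>ln (1 + \<xi> j)\<close> are i.i.d., and they are bounded because \<open>P 0 0 < 1\<close>. An \<open>O(ln n)\<close> error
  is invisible after division by \<open>n\<close>, so the three growth rates are those of this walk. For the moments,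
  independence gives \<open>E(exp (p * sum)) = (E((1 + \<xi> 0) powr p)) ^ n\<close>. For the almost sure rate, the strong
  law is derived from Hoeffding's inequality and the Borel-Cantelli lemma. The mean is linear. Both
  of the last two limits equal \<open>E(ln (1 + \<xi> 0))\<close>, which is the derivative of \<open>\<Gamma>\<close> at \<open>0\<close> by
  differentiation under the expectation (\<open>exponential_moment_has_derivative\<close>).

  Existence and uniqueness hold path by path, because the equation is an explicit recursion in time
  (\<open>solution_unique_pathwise\<close>).
\<close>

section \<open>Exponential moments and growth rates of bounded i.i.d. sums\<close>

lemma exp_taylor_one_bound:
  fixes t :: real
  assumes "\<bar>t\<bar> \<le> 1"
  shows "\<bar>exp t - 1 - t\<bar> \<le> t\<^sup>2"
proof -
  have "exp t \<le> 1 + t + t\<^sup>2"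
  proof (cases "0 \<le> t")
    case True
    then show ?thesis using assms by (intro exp_bound) auto
  next
    case False
    have "1 - t \<le> exp (- t)" using exp_ge_add_one_self[of "- t"] by simp
    then have "exp t \<le> 1 / (1 - t)"
      using False by (simp add: exp_minus field_simps)
    also have "\<dots> \<le> 1 + t + t\<^sup>2"
    proof -
      have "(1 - t) * (1 + t + t\<^sup>2) = 1 - t * t\<^sup>2"
        by (simp add: algebra_simps power2_eq_square)
      moreover have "t * t\<^sup>2 \<le> 0" using False by (intro mult_nonpos_nonneg) auto
      ultimately show ?thesis using False by (simp add: divide_le_eq mult.commute)
    qed
    finally show ?thesis .
  qed
  then show ?thesis
    using exp_ge_add_one_self[of t] zero_le_power2[of t] by linarith
qed

lemma (in prob_space) integrable_exp_bounded:
  fixes X :: "'a \<Rightarrow> real"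
  assumes [measurable]: "X \<in> borel_measurable M"
    and bound: "\<And>\<omega>. \<bar>X \<omega>\<bar> \<le> L"
  shows "integrable M (\<lambda>\<omega>. exp (h * X \<omega>))"
proof (rule integrable_const_bound[of _ "exp (\<bar>h\<bar> * L)"])
  show "AE \<omega> in M. norm (exp (h * X \<omega>)) \<le> exp (\<bar>h\<bar> * L)"
  proof (rule AE_I2)
    fix \<omega>
    have "h * X \<omega> \<le> \<bar>h\<bar> * \<bar>X \<omega>\<bar>" by (metis abs_ge_self abs_mult)
    also have "\<dots> \<le> \<bar>h\<bar> * L" using bound by (intro mult_left_mono) auto
    finally show "norm (exp (h * X \<omega>)) \<le> exp (\<bar>h\<bar> * L)" by simp
  qed
qed auto

text \<open>The Taylor remainder of \<open>exp (h * X)\<close> is at most \<open>h\<^sup>2 * L\<^sup>2\<close>, uniformly in the sample point,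
  so the difference quotient may be evaluated under the integral.\<close>

lemma (in prob_space) exponential_moment_has_derivative:
  fixes X :: "'a \<Rightarrow> real"
  assumes [measurable]: "X \<in> borel_measurable M"
    and bound: "\<And>\<omega>. \<bar>X \<omega>\<bar> \<le> L"
  shows "((\<lambda>p. expectation (\<lambda>\<omega>. exp (p * X \<omega>))) has_real_derivative expectation X) (at 0)"
proof -
  have L: "0 \<le> L" using bound[of undefined] by linarith
  have intX: "integrable M X"
    by (rule integrable_const_bound[of _ L]) (auto simp: bound)
  have inte: "integrable M (\<lambda>\<omega>. exp (h * X \<omega>))" for h
    using assms by (rule integrable_exp_bounded)
  have remainder: "\<bar>(expectation (\<lambda>\<omega>. exp (h * X \<omega>)) - 1) / h - expectation X\<bar> \<le> \<bar>h\<bar> * L\<^sup>2"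
    if h: "h \<noteq> 0" "\<bar>h\<bar> * L \<le> 1" for h
  proof -
    have "\<bar>expectation (\<lambda>\<omega>. exp (h * X \<omega>)) - 1 - h * expectation X\<bar>
        = \<bar>expectation (\<lambda>\<omega>. exp (h * X \<omega>) - 1 - h * X \<omega>)\<bar>"
      using inte intX by (simp add: prob_space)
    also have "\<dots> \<le> expectation (\<lambda>\<omega>. \<bar>exp (h * X \<omega>) - 1 - h * X \<omega>\<bar>)"
      by (rule integral_abs_bound)
    also have "\<dots> \<le> expectation (\<lambda>\<omega>. h\<^sup>2 * L\<^sup>2)"
    proof (rule integral_mono)
      show "integrable M (\<lambda>\<omega>. \<bar>exp (h * X \<omega>) - 1 - h * X \<omega>\<bar>)"
        using inte intX by auto
      fix \<omega>
      have small: "\<bar>h * X \<omega>\<bar> \<le> \<bar>h\<bar> * L"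
        using bound by (simp add: abs_mult mult_left_mono)
      have "\<bar>exp (h * X \<omega>) - 1 - h * X \<omega>\<bar> \<le> (h * X \<omega>)\<^sup>2"
        using small h by (intro exp_taylor_one_bound) auto
      also have "\<dots> \<le> (\<bar>h\<bar> * L)\<^sup>2"
        using small by (metis abs_ge_zero power2_abs power_mono)
      finally show "\<bar>exp (h * X \<omega>) - 1 - h * X \<omega>\<bar> \<le> h\<^sup>2 * L\<^sup>2"
        by (simp add: power_mult_distrib)
    qed auto
    finally have "\<bar>expectation (\<lambda>\<omega>. exp (h * X \<omega>)) - 1 - h * expectation X\<bar> \<le> h\<^sup>2 * L\<^sup>2"
      by (simp add: prob_space)
    then have "\<bar>expectation (\<lambda>\<omega>. exp (h * X \<omega>)) - 1 - h * expectation X\<bar> / \<bar>h\<bar> \<le> h\<^sup>2 * L\<^sup>2 / \<bar>h\<bar>"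
      by (rule divide_right_mono) simp
    moreover have "\<bar>expectation (\<lambda>\<omega>. exp (h * X \<omega>)) - 1 - h * expectation X\<bar> / \<bar>h\<bar>
        = \<bar>(expectation (\<lambda>\<omega>. exp (h * X \<omega>)) - 1) / h - expectation X\<bar>"
      using h by (simp add: diff_divide_distrib flip: abs_divide)
    moreover have "h\<^sup>2 * L\<^sup>2 / \<bar>h\<bar> = \<bar>h\<bar> * L\<^sup>2"
    proof -
      have "h\<^sup>2 * L\<^sup>2 = \<bar>h\<bar> * (\<bar>h\<bar> * L\<^sup>2)" by (simp add: power2_eq_square)
      then show ?thesis using h by (metis abs_eq_0 nonzero_mult_div_cancel_left)
    qed
    ultimately show ?thesis by simp
  qed
  have small: "\<forall>\<^sub>F h in at (0::real). \<bar>h\<bar> * L \<le> 1"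
  proof -
    have "((\<lambda>h. \<bar>h\<bar> * L) \<longlongrightarrow> \<bar>0\<bar> * L) (at (0::real))" by (intro tendsto_intros)
    then have "\<forall>\<^sub>F h in at (0::real). \<bar>h\<bar> * L < 1" by (rule order_tendstoD) simp
    then show ?thesis by (rule eventually_mono) simp
  qed
  have "((\<lambda>h. (expectation (\<lambda>\<omega>. exp (h * X \<omega>)) - 1) / h - expectation X) \<longlongrightarrow> 0) (at 0)"
  proof (rule Lim_null_comparison)
    show "\<forall>\<^sub>F h in at 0. norm ((expectation (\<lambda>\<omega>. exp (h * X \<omega>)) - 1) / h - expectation X)
        \<le> \<bar>h\<bar> * L\<^sup>2"
      using small eventually_neq_at_within[of 0 0 UNIV]
      by eventually_elim (use remainder in auto)
    have "((\<lambda>h. \<bar>h\<bar> * L\<^sup>2) \<longlongrightarrow> \<bar>0\<bar> * L\<^sup>2) (at (0::real))" by (intro tendsto_intros)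
    then show "((\<lambda>h. \<bar>h\<bar> * L\<^sup>2) \<longlongrightarrow> 0) (at (0::real))" by simp
  qed
  then have "((\<lambda>h. (expectation (\<lambda>\<omega>. exp (h * X \<omega>)) - 1) / h) \<longlongrightarrow> expectation X) (at 0)"
    by (rule Lim_null[THEN iffD2])
  then show ?thesis by (simp add: DERIV_def prob_space)
qed

locale bounded_iid_sequence = prob_space +
  fixes X :: "nat \<Rightarrow> 'a \<Rightarrow> real" and L :: real
  assumes indep: "indep_vars (\<lambda>_. borel) X UNIV"
    and identical: "distr M borel (X n) = distr M borel (X 0)"
    and bounded: "\<bar>X n \<omega>\<bar> \<le> L"
begin

lemma measurable_X [measurable]: "X n \<in> borel_measurable M"
  using indep unfolding indep_vars_def by auto

lemma bound_nonneg: "0 \<le> L"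
  using bounded[of 0 undefined] by linarith

lemma integrable_X: "integrable M (X n)"
  by (rule integrable_const_bound[of _ L]) (auto simp: bounded)

lemma expectation_comp_X:
  assumes [measurable]: "f \<in> borel_measurable borel"
  shows "expectation (\<lambda>\<omega>. f (X n \<omega>)) = expectation (\<lambda>\<omega>. f (X 0 \<omega>) :: real)"
proof -
  have "expectation (\<lambda>\<omega>. f (X n \<omega>)) = (\<integral>x. f x \<partial>distr M borel (X n))"
    by (subst integral_distr) auto
  also have "\<dots> = (\<integral>x. f x \<partial>distr M borel (X 0))" using identical[of n] by simp
  also have "\<dots> = expectation (\<lambda>\<omega>. f (X 0 \<omega>))" by (subst integral_distr) auto
  finally show ?thesis .
qed

lemma expectation_X: "expectation (X n) = expectation (X 0)"
  using expectation_comp_X[of "\<lambda>x. x" n] by simp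

lemma abs_sum_le: "\<bar>\<Sum>j<n. X j \<omega>\<bar> \<le> real n * L"
proof -
  have "\<bar>\<Sum>j<n. X j \<omega>\<bar> \<le> (\<Sum>j<n. \<bar>X j \<omega>\<bar>)" by (rule sum_abs)
  also have "\<dots> \<le> (\<Sum>j<n. L)" by (intro sum_mono bounded)
  finally show ?thesis by simp
qed

lemma integrable_sum: "integrable M (\<lambda>\<omega>. \<Sum>j<n. X j \<omega>)"
  by (intro Bochner_Integration.integrable_sum integrable_X)

lemma expectation_sum: "expectation (\<lambda>\<omega>. \<Sum>j<n. X j \<omega>) = real n * expectation (X 0)"
proof -
  have "expectation (\<lambda>\<omega>. \<Sum>j<n. X j \<omega>) = (\<Sum>j<n. expectation (X j))"
    by (rule Bochner_Integration.integral_sum) (rule integrable_X)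
  also have "\<dots> = (\<Sum>j<n. expectation (X 0))"
    by (intro sum.cong refl expectation_X)
  finally show ?thesis by simp
qed

lemma integrable_exp_X: "integrable M (\<lambda>\<omega>. exp (p * X n \<omega>))"
  using measurable_X bounded by (rule integrable_exp_bounded)

lemma integrable_exp_sum: "integrable M (\<lambda>\<omega>. exp (p * (\<Sum>j<n. X j \<omega>)))"
  by (rule integrable_exp_bounded[OF _ abs_sum_le]) measurable

lemma exponential_moment_pos: "0 < expectation (\<lambda>\<omega>. exp (p * X n \<omega>))"
proof -
  have "exp (- (\<bar>p\<bar> * L)) \<le> expectation (\<lambda>\<omega>. exp (p * X n \<omega>))"
  proof (rule integral_ge_const[OF integrable_exp_X], rule AE_I2)
    fix \<omega>
    have "\<bar>p * X n \<omega>\<bar> \<le> \<bar>p\<bar> * L"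
      using bounded by (simp add: abs_mult mult_left_mono)
    then show "exp (- (\<bar>p\<bar> * L)) \<le> exp (p * X n \<omega>)" by simp
  qed
  then show ?thesis by (rule less_le_trans[OF exp_gt_zero])
qed

lemma exponential_moment_sum:
  "expectation (\<lambda>\<omega>. exp (p * (\<Sum>j<n. X j \<omega>))) = expectation (\<lambda>\<omega>. exp (p * X 0 \<omega>)) ^ n"
proof -
  have ind: "indep_vars (\<lambda>_. borel) (\<lambda>j \<omega>. exp (p * X j \<omega>)) {..<n}"
    by (rule indep_vars_compose2[OF indep_vars_subset[OF indep]]) auto
  have "expectation (\<lambda>\<omega>. exp (p * (\<Sum>j<n. X j \<omega>))) = expectation (\<lambda>\<omega>. \<Prod>j<n. exp (p * X j \<omega>))"
    by (simp add: sum_distrib_left exp_sum)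
  also have "\<dots> = (\<Prod>j<n. expectation (\<lambda>\<omega>. exp (p * X j \<omega>)))"
    using ind integrable_exp_X by (intro indep_vars_lebesgue_integral) auto
  also have "\<dots> = (\<Prod>j<n. expectation (\<lambda>\<omega>. exp (p * X 0 \<omega>)))"
    by (intro prod.cong refl expectation_comp_X) auto
  finally show ?thesis by simp
qed

text \<open>For bounded summands, the deviation probabilities decay geometrically by Hoeffding's
  inequality, and the Borel-Cantelli lemma turns this into almost sure convergence.\<close>

lemma strong_law: "AE \<omega> in M. (\<lambda>n. (\<Sum>j<n. X j \<omega>) / real n) \<longlonglongrightarrow> expectation (X 0)"
proof -
  define \<mu> where "\<mu> = expectation (X 0)"
  define bad where "bad e n = {\<omega> \<in> space M. e \<le> \<bar>(\<Sum>j<Suc n. X j \<omega>) / real (Suc n) - \<mu>\<bar>}" for e n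
  have [measurable]: "bad e n \<in> sets M" for e n
    unfolding bad_def by measurable
  have prob_bad: "prob (bad e n) \<le> 2 * exp (- (2 * e\<^sup>2 / (2 * L + 1)\<^sup>2)) ^ Suc n" if e: "0 < e" for e n
  proof -
    \<comment> \<open>The interval \<open>{- L..L}\<close> is enlarged because Hoeffding's inequality needs positive length.\<close>
    interpret H: Hoeffding_ineq_iid M "{..<Suc n}" X "X 0" "- L" "L + 1" \<mu>
    proof unfold_locales
      show "indep_vars (\<lambda>_. borel) X {..<Suc n}" by (rule indep_vars_subset[OF indep]) auto
      show "AE x in M. X 0 x \<in> {- L..L + 1}"
      proof (rule AE_I2)
        fix x
        show "X 0 x \<in> {- L..L + 1}" using bounded[of 0 x] by auto
      qed
      show "distr M borel (X i) = distr M borel (X 0)" for i by (rule identical)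
    qed (auto simp: \<mu>_def)
    have "prob (bad e n) \<le> 2 * exp (- 2 * real (Suc n) * e\<^sup>2 / (L + 1 - - L)\<^sup>2)"
      using H.Hoeffding_ineq_abs_ge'[of e] e bound_nonneg by (simp add: bad_def lessThan_empty_iff)
    also have "\<dots> = 2 * exp (- (2 * e\<^sup>2 / (2 * L + 1)\<^sup>2)) ^ Suc n"
    proof -
      have "L + 1 - - L = 2 * L + 1" by simp
      then show ?thesis
        by (subst exp_of_nat_mult[symmetric]) (simp del: of_nat_Suc add: mult.left_commute)
    qed
    finally show ?thesis .
  qed
  have rare: "AE \<omega> in M. \<forall>\<^sub>F n in sequentially. \<omega> \<in> space M - bad e n" if e: "0 < e" for e
  proof (rule borel_cantelli_AE1)
    have "exp (- (2 * e\<^sup>2 / (2 * L + 1)\<^sup>2)) < 1"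
      using e bound_nonneg by simp
    then have "summable (\<lambda>n. exp (- (2 * e\<^sup>2 / (2 * L + 1)\<^sup>2)) ^ Suc n)"
      by (subst summable_Suc_iff) (auto intro: summable_geometric)
    then have "summable (\<lambda>n. 2 * exp (- (2 * e\<^sup>2 / (2 * L + 1)\<^sup>2)) ^ Suc n)"
      by (rule summable_mult)
    then show "summable (\<lambda>n. prob (bad e n))"
      by (rule summable_comparison_test_ev[rotated]) (use prob_bad[OF e] in \<open>auto simp: measure_nonneg\<close>)
  qed (auto simp: emeasure_eq_measure)
  have "AE \<omega> in M. \<forall>k. \<forall>\<^sub>F n in sequentially. \<omega> \<in> space M - bad (1 / real (Suc k)) n"
    unfolding AE_all_countable by (intro allI rare) simp
  then have "AE \<omega> in M. (\<lambda>n. (\<Sum>j<Suc n. X j \<omega>) / real (Suc n)) \<longlonglongrightarrow> \<mu>"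
  proof eventually_elim
    case (elim \<omega>)
    show ?case
    proof (rule tendstoI)
      fix e :: real assume "0 < e"
      then obtain k where k: "1 / real (Suc k) < e" using nat_approx_posE by blast
      have "\<forall>\<^sub>F n in sequentially. \<omega> \<in> space M - bad (1 / real (Suc k)) n" using elim by blast
      then show "\<forall>\<^sub>F n in sequentially. dist ((\<Sum>j<Suc n. X j \<omega>) / real (Suc n)) \<mu> < e"
        by (rule eventually_mono) (use k in \<open>auto simp: bad_def dist_real_def\<close>)
    qed
  qed
  then show ?thesis
    unfolding \<mu>_def by eventually_elim (rule LIMSEQ_imp_Suc)
qed

text \<open>A process that stays within a deterministic sublinear distance of the partial sums has the
  same almost sure, mean and exponential-moment growth rates as the sums themselves.\<close>

context
  fixes Z :: "nat \<Rightarrow> 'a \<Rightarrow> real" and b :: "nat \<Rightarrow> real"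
  assumes Z_measurable [measurable]: "\<And>n. Z n \<in> borel_measurable M"
    and near: "\<And>n \<omega>. \<bar>Z n \<omega> - (\<Sum>j<n. X j \<omega>)\<bar> \<le> b n"
    and sublinear: "(\<lambda>n. b n / real n) \<longlonglongrightarrow> 0"
begin

lemma tendsto_of_linear_error:
  fixes f g :: "nat \<Rightarrow> real"
  assumes "\<And>n. \<bar>f n - g n\<bar> \<le> c * b n" and "(\<lambda>n. g n / real n) \<longlonglongrightarrow> l"
  shows "(\<lambda>n. 1 / real n * f n) \<longlonglongrightarrow> l"
proof -
  have "(\<lambda>n. (f n - g n) / real n) \<longlonglongrightarrow> 0"
  proof (rule Lim_null_comparison)
    show "\<forall>\<^sub>F n in sequentially. norm ((f n - g n) / real n) \<le> c * (b n / real n)"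
      using assms(1) by (intro always_eventually allI) (simp add: divide_right_mono)
    show "(\<lambda>n. c * (b n / real n)) \<longlonglongrightarrow> 0"
      using tendsto_mult_right[OF sublinear, of c] by (simp add: mult.commute)
  qed
  from tendsto_add[OF this assms(2)] show ?thesis
    by (simp add: diff_divide_distrib)
qed

lemma growth_rate_almost_surely: "AE \<omega> in M. (\<lambda>n. 1 / real n * Z n \<omega>) \<longlonglongrightarrow> expectation (X 0)"
  using strong_law by eventually_elim (rule tendsto_of_linear_error[where c = 1], use near in auto)

lemma integrable_near: "integrable M (Z n)"
proof (rule integrable_const_bound[of _ "b n + real n * L"])
  show "AE \<omega> in M. norm (Z n \<omega>) \<le> b n + real n * L"
  proof (rule AE_I2)
    fix \<omega>
    have "\<bar>Z n \<omega> - (\<Sum>j<n. X j \<omega>)\<bar> \<le> b n" by (rule near)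
    then show "norm (Z n \<omega>) \<le> b n + real n * L"
      using abs_sum_le[of \<omega> n] by (simp only: real_norm_def)
  qed
qed auto

lemma growth_rate_mean: "(\<lambda>n. 1 / real n * expectation (Z n)) \<longlonglongrightarrow> expectation (X 0)"
proof (rule tendsto_of_linear_error[where c = 1])
  fix n
  have "\<bar>expectation (Z n) - real n * expectation (X 0)\<bar>
      = \<bar>expectation (\<lambda>\<omega>. Z n \<omega> - (\<Sum>j<n. X j \<omega>))\<bar>"
    by (simp add: integrable_near integrable_near integrable_sum expectation_sum)
  also have "\<dots> \<le> expectation (\<lambda>\<omega>. \<bar>Z n \<omega> - (\<Sum>j<n. X j \<omega>)\<bar>)"
    by (rule integral_abs_bound)
  also have "\<dots> \<le> expectation (\<lambda>\<omega>. b n)"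
    by (rule integral_mono) (auto simp: integrable_near integrable_X near)
  finally show "\<bar>expectation (Z n) - real n * expectation (X 0)\<bar> \<le> 1 * b n"
    by (simp add: prob_space)
next
  show "(\<lambda>n. real n * expectation (X 0) / real n) \<longlonglongrightarrow> expectation (X 0)"
    by (rule tendsto_eventually)
      (auto simp: eventually_sequentially intro!: exI[of _ 1])
qed

lemma exp_near:
  "exp (p * Z n \<omega>) \<le> exp (\<bar>p\<bar> * b n) * exp (p * (\<Sum>j<n. X j \<omega>))"
  "exp (- (\<bar>p\<bar> * b n)) * exp (p * (\<Sum>j<n. X j \<omega>)) \<le> exp (p * Z n \<omega>)"
proof -
  have "\<bar>p * (Z n \<omega> - (\<Sum>j<n. X j \<omega>))\<bar> \<le> \<bar>p\<bar> * b n"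
    using near by (simp add: abs_mult mult_left_mono)
  then show "exp (p * Z n \<omega>) \<le> exp (\<bar>p\<bar> * b n) * exp (p * (\<Sum>j<n. X j \<omega>))"
    "exp (- (\<bar>p\<bar> * b n)) * exp (p * (\<Sum>j<n. X j \<omega>)) \<le> exp (p * Z n \<omega>)"
    unfolding exp_add[symmetric] by (auto simp: algebra_simps)
qed

lemma integrable_exp_near: "integrable M (\<lambda>\<omega>. exp (p * Z n \<omega>))"
proof (rule Bochner_Integration.integrable_bound)
  show "integrable M (\<lambda>\<omega>. exp (\<bar>p\<bar> * b n) * exp (p * (\<Sum>j<n. X j \<omega>)))"
    using integrable_exp_sum by simp
qed (auto intro!: AE_I2 exp_near)

lemma growth_rate_moment:
  "(\<lambda>n. 1 / real n * ln (expectation (\<lambda>\<omega>. exp (p * Z n \<omega>))))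
     \<longlonglongrightarrow> ln (expectation (\<lambda>\<omega>. exp (p * X 0 \<omega>)))"
proof (rule tendsto_of_linear_error[where c = "\<bar>p\<bar>"])
  fix n
  define \<phi> where "\<phi> = expectation (\<lambda>\<omega>. exp (p * X 0 \<omega>))"
  define m where "m = expectation (\<lambda>\<omega>. exp (p * Z n \<omega>))"
  have \<phi>: "0 < \<phi>" unfolding \<phi>_def by (rule exponential_moment_pos)
  have up: "m \<le> exp (\<bar>p\<bar> * b n) * \<phi> ^ n"
  proof -
    have "m \<le> expectation (\<lambda>\<omega>. exp (\<bar>p\<bar> * b n) * exp (p * (\<Sum>j<n. X j \<omega>)))"
      unfolding m_def by (intro integral_mono integrable_exp_near integrable_mult_right integrable_exp_sum exp_near)
    then show ?thesis by (simp add: exponential_moment_sum \<phi>_def)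
  qed
  have low: "exp (- (\<bar>p\<bar> * b n)) * \<phi> ^ n \<le> m"
  proof -
    have "expectation (\<lambda>\<omega>. exp (- (\<bar>p\<bar> * b n)) * exp (p * (\<Sum>j<n. X j \<omega>))) \<le> m"
      unfolding m_def by (intro integral_mono integrable_exp_near integrable_mult_right integrable_exp_sum exp_near)
    then show ?thesis by (simp add: exponential_moment_sum \<phi>_def)
  qed
  have ln_prod: "ln (exp t * \<phi> ^ n) = t + real n * ln \<phi>" for t
    using \<phi> by (simp add: ln_mult ln_realpow)
  have m: "0 < m" using low \<phi> by (smt (verit) exp_gt_zero mult_pos_pos zero_less_power)
  have "ln m \<le> \<bar>p\<bar> * b n + real n * ln \<phi>"
    using up m \<phi> by (subst ln_prod[symmetric]) simp
  moreover have "- (\<bar>p\<bar> * b n) + real n * ln \<phi> \<le> ln m"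
    using low m \<phi> by (subst ln_prod[symmetric]) simp
  ultimately show "\<bar>ln m - real n * ln \<phi>\<bar> \<le> \<bar>p\<bar> * b n" by simp
next
  show "(\<lambda>n. real n * ln (expectation (\<lambda>\<omega>. exp (p * X 0 \<omega>))) / real n)
      \<longlonglongrightarrow> ln (expectation (\<lambda>\<omega>. exp (p * X 0 \<omega>)))"
    by (rule tendsto_eventually)
      (auto simp: eventually_sequentially intro!: exI[of _ 1])
qed

end

end

section \<open>Lattice boxes\<close>

definition lattice_box :: "nat \<Rightarrow> (int ^ 'd::finite) set" where
  "lattice_box r = {x. \<forall>i. \<bar>x $ i\<bar> \<le> int r}"

lemma lattice_box_eq_preimage:
  "lattice_box r = vec_nth -` (\<Pi>\<^sub>E i\<in>UNIV. {- int r..int r})"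
  by (auto simp: lattice_box_def PiE_iff abs_le_iff minus_le_iff)

lemma finite_lattice_box [simp]: "finite (lattice_box r :: (int ^ 'd::finite) set)"
  unfolding lattice_box_eq_preimage
  by (intro finite_vimageI finite_PiE) (auto simp: inj_def vec_nth_inject)

text \<open>The number of sites that a point mass can reach in \<open>n\<close> steps grows only polynomially in
  \<open>n\<close>; this is why the supremum and the total mass have the same exponential growth rate.\<close>

lemma card_lattice_box:
  "card (lattice_box r :: (int ^ 'd::finite) set) \<le> (2 * r + 1) ^ CARD('d)"
proof -
  have "card (lattice_box r :: (int ^ 'd) set) \<le> card (\<Pi>\<^sub>E i\<in>(UNIV :: 'd set). {- int r..int r})"
    unfolding lattice_box_eq_preimage
    by (rule card_inj_on_le[of vec_nth]) (auto simp: inj_on_def vec_nth_inject intro!: finite_PiE)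
  also have "\<dots> = (2 * r + 1) ^ CARD('d)"
    by (simp add: card_PiE nat_add_distrib nat_mult_distrib flip: mult_2)
  finally show ?thesis .
qed

lemma zero_in_lattice_box [simp]: "0 \<in> lattice_box r"
  by (simp add: lattice_box_def)

lemma ex_lattice_box: "\<exists>r. (x :: int ^ 'd::finite) \<in> lattice_box r"
proof -
  have "nat \<bar>x $ i\<bar> \<le> (\<Sum>i\<in>UNIV. nat \<bar>x $ i\<bar>)" for i
    by (rule member_le_sum) auto
  then have "\<bar>x $ i\<bar> \<le> int (\<Sum>i\<in>UNIV. nat \<bar>x $ i\<bar>)" for i
    by (metis abs_ge_zero nat_le_iff)
  then show ?thesis unfolding lattice_box_def by blast
qed

lemma lattice_box_diff:
  assumes "x + k \<in> lattice_box r" and "k \<in> lattice_box s"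
  shows "x \<in> lattice_box (r + s)"
  unfolding lattice_box_def
proof (intro CollectI allI)
  fix i
  have "\<bar>x $ i + k $ i\<bar> \<le> int r" "\<bar>k $ i\<bar> \<le> int s"
    using assms by (auto simp: lattice_box_def)
  then show "\<bar>x $ i\<bar> \<le> int (r + s)" by linarith
qed

text \<open>Euclidean balls are replaced by the boxes that contain them, because the cardinality of a box
  is explicit.\<close>

lemma local_kernel_range:
  assumes "local_kernel P"
  obtains N where "\<And>k. k \<notin> lattice_box N \<Longrightarrow> P 0 k = 0"
proof -
  from assms obtain R where
    R: "\<And>k. norm (\<chi> i. real_of_int (k $ i)) > R \<Longrightarrow> P 0 k = 0"
    unfolding local_kernel_def by blast
  have "P 0 k = 0" if k: "k \<notin> lattice_box (nat \<lceil>R\<rceil>)" for k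
  proof (rule R)
    from k obtain i where "int (nat \<lceil>R\<rceil>) < \<bar>k $ i\<bar>"
      by (auto simp: lattice_box_def not_le)
    then have "R < \<bar>real_of_int (k $ i)\<bar>" by linarith
    also have "\<dots> \<le> norm (\<chi> i. real_of_int (k $ i))"
      using component_le_norm_cart[of "\<chi> i. real_of_int (k $ i)" i] by simp
    finally show "norm (\<chi> i. real_of_int (k $ i)) > R" .
  qed
  then show ?thesis by (rule that)
qed

section \<open>The equation with deterministic noise\<close>

text \<open>The model is solved path by path: \<open>a\<close> is one realization of the noise, \<open>f\<close> the initial
  profile.\<close>

primrec driven_field ::
  "(int ^ 'd \<Rightarrow> int ^ 'd \<Rightarrow> real) \<Rightarrow> (nat \<Rightarrow> real) \<Rightarrow> (int ^ 'd \<Rightarrow> real) \<Rightarrow> nat \<Rightarrow> int ^ 'd \<Rightarrow> real"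
where
  "driven_field P a f 0 x = f x"
| "driven_field P a f (Suc n) x =
     transition_operator P (driven_field P a f n) x + a n * driven_field P a f n x"

lemma has_sum_finite_combination:
  fixes g :: "'i \<Rightarrow> 'a \<Rightarrow> real"
  assumes "finite A" and "\<And>k. k \<in> A \<Longrightarrow> (g k has_sum s k) B"
  shows "((\<lambda>x. \<Sum>k\<in>A. g k x) has_sum (\<Sum>k\<in>A. s k)) B"
  using assms by (induction A) (auto intro!: has_sum_add)

locale local_walk =
  fixes P :: "int ^ 'd::finite \<Rightarrow> int ^ 'd \<Rightarrow> real" and N :: nat
  assumes kernel: "random_walk_kernel P"
    and range: "k \<notin> lattice_box N \<Longrightarrow> P 0 k = 0"
begin

lemma P_nonneg: "0 \<le> P x y"
  using kernel by (simp add: random_walk_kernel_def)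

lemma P_shift: "P x (x + k) = P 0 k"
proof -
  have "P x (x + k) = P 0 ((x + k) - x)"
    using kernel unfolding random_walk_kernel_def by blast
  then show ?thesis by simp
qed

lemma total_step_mass: "(\<Sum>k\<in>lattice_box N. P 0 k) = 1"
proof -
  have "(P 0 has_sum 1) UNIV" using kernel by (simp add: random_walk_kernel_def)
  then have "(P 0 has_sum 1) (lattice_box N)"
    by (rule has_sum_cong_neutral[THEN iffD1, rotated -1]) (auto simp: range)
  then show ?thesis
    using has_sum_finite[OF finite_lattice_box] has_sum_unique by blast
qed

text \<open>The jump distribution with the noise absorbed into its atom at the origin. The condition
  that the noise is bounded by \<open>P 0 0\<close> says exactly that this is still a nonnegative measure, and
  nonnegativity and monotonicity of the evolution follow from it.\<close>

definition tilted_mass :: "real \<Rightarrow> int ^ 'd \<Rightarrow> real" where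
  "tilted_mass s k = P 0 k + (if k = 0 then s else 0)"

lemma tilted_mass_nonneg: "\<bar>s\<bar> \<le> P 0 0 \<Longrightarrow> 0 \<le> tilted_mass s k"
  using P_nonneg by (auto simp: tilted_mass_def)

lemma sum_tilted_mass: "(\<Sum>k\<in>lattice_box N. tilted_mass s k) = 1 + s"
  by (simp add: tilted_mass_def sum.distrib total_step_mass)

lemma transition_operator_finite:
  "transition_operator P h x = (\<Sum>k\<in>lattice_box N. P 0 k * h (x + k))"
proof -
  have "transition_operator P h x = (\<Sum>\<^sub>\<infinity>k. P x (x + k) * h (x + k))"
    unfolding transition_operator_def
    by (rule infsum_reindex_bij_betw[symmetric]) (rule bij_plus)
  also have "\<dots> = (\<Sum>\<^sub>\<infinity>k\<in>lattice_box N. P 0 k * h (x + k))"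
    by (rule infsum_cong_neutral) (auto simp: range P_shift)
  finally show ?thesis by simp
qed

lemma one_step:
  "transition_operator P h x + s * h x = (\<Sum>k\<in>lattice_box N. tilted_mass s k * h (x + k))"
proof -
  have "(\<Sum>k::int ^ 'd\<in>lattice_box N. (if k = 0 then s else 0) * h (x + k))
      = (\<Sum>k::int ^ 'd\<in>lattice_box N. if k = 0 then s * h x else 0)"
    by (rule sum.cong) auto
  also have "\<dots> = s * h x" by simp
  finally show ?thesis
    unfolding transition_operator_finite tilted_mass_def by (simp add: distrib_right sum.distrib)
qed

lemma driven_field_Suc:
  "driven_field P a f (Suc n) x
    = (\<Sum>k\<in>lattice_box N. tilted_mass (a n) k * driven_field P a f n (x + k))"
  by (simp add: one_step)

lemma driven_field_mono:
  assumes "\<And>n. \<bar>a n\<bar> \<le> P 0 0" and "\<And>x. f x \<le> g x"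
  shows "driven_field P a f n x \<le> driven_field P a g n x"
proof (induction n arbitrary: x)
  case 0
  then show ?case using assms(2) by simp
next
  case (Suc n)
  then show ?case
    unfolding driven_field_Suc
    by (intro sum_mono mult_left_mono tilted_mass_nonneg assms(1))
qed

lemma driven_field_nonneg:
  assumes "\<And>n. \<bar>a n\<bar> \<le> P 0 0" and "\<And>x. 0 \<le> f x"
  shows "0 \<le> driven_field P a f n x"
proof (induction n arbitrary: x)
  case 0
  then show ?case using assms(2) by simp
next
  case (Suc n)
  then show ?case
    unfolding driven_field_Suc
    by (intro sum_nonneg mult_nonneg_nonneg tilted_mass_nonneg assms(1))
qed

text \<open>The kernel conserves mass, so the noise \<open>a j\<close>, being the same at all sites, multiplies the
  total mass by exactly \<open>1 + a j\<close>.\<close>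

lemma total_mass:
  assumes "(f has_sum s) UNIV"
  shows "(driven_field P a f n has_sum (s * (\<Prod>j<n. 1 + a j))) UNIV"
proof (induction n)
  case 0
  have "driven_field P a f 0 = f" by (rule ext) simp
  then show ?case using assms by simp
next
  case (Suc n)
  define S where "S = s * (\<Prod>j<n. 1 + a j)"
  have "((\<lambda>x. \<Sum>k\<in>lattice_box N. tilted_mass (a n) k * driven_field P a f n (x + k))
      has_sum (\<Sum>k\<in>lattice_box N. tilted_mass (a n) k * S)) UNIV"
  proof (rule has_sum_finite_combination)
    fix k :: "int ^ 'd"
    have "((\<lambda>x. driven_field P a f n (x + k)) has_sum S) UNIV"
      using Suc.IH unfolding S_def
      by (subst has_sum_reindex_bij_betw[where g = "\<lambda>x. x + k" and B = UNIV]) (auto intro: bij_plus_right)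
    then show "((\<lambda>x. tilted_mass (a n) k * driven_field P a f n (x + k))
        has_sum (tilted_mass (a n) k * S)) UNIV"
      by (rule has_sum_cmult_right)
  qed simp
  moreover have "(\<Sum>k\<in>lattice_box N. tilted_mass (a n) k * S) = s * (\<Prod>j<Suc n. 1 + a j)"
    by (simp add: S_def sum_tilted_mass flip: sum_distrib_right)
  moreover have "driven_field P a f (Suc n)
      = (\<lambda>x. \<Sum>k\<in>lattice_box N. tilted_mass (a n) k * driven_field P a f n (x + k))"
    by (rule ext) (rule driven_field_Suc)
  ultimately show ?case by metis
qed

lemma driven_field_support:
  assumes "\<And>x. x \<notin> lattice_box r \<Longrightarrow> f x = 0" and "x \<notin> lattice_box (r + n * N)"
  shows "driven_field P a f n x = 0"
  using assms(2)
proof (induction n arbitrary: x)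
  case 0
  then show ?case using assms(1) by simp
next
  case (Suc n)
  have "x + k \<notin> lattice_box (r + n * N)" if "k \<in> lattice_box N" for k
    using lattice_box_diff[OF _ that, of x "r + n * N"] Suc.prems by (auto simp: ac_simps)
  then show ?case unfolding driven_field_Suc by (intro sum.neutral) (auto simp: Suc.IH)
qed

lemma driven_field_le_total_mass:
  assumes "\<And>n. \<bar>a n\<bar> \<le> P 0 0" and "\<And>x. 0 \<le> f x" and "(f has_sum s) UNIV"
  shows "driven_field P a f n x \<le> s * (\<Prod>j<n. 1 + a j)"
proof -
  have "(driven_field P a f n has_sum driven_field P a f n x) {x}"
    by (rule has_sum_finiteI) auto
  then show ?thesis
    using total_mass[OF assms(3)] by (rule has_sum_mono2) (auto intro: driven_field_nonneg assms)
qed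

text \<open>The initial profile need not have finite support. By monotonicity it may be replaced by the
  point mass that it carries at \<open>z\<close>; the field \<open>g\<close> started there has an explicit total mass, spread
  over a box of polynomial size, so by the pigeonhole principle the supremum cannot be much smaller
  than the total mass.\<close>

lemma sup_lower_bound:
  assumes a: "\<And>n. \<bar>a n\<bar> \<le> P 0 0" and f: "\<And>x. 0 \<le> f x"
    and z: "z \<in> lattice_box r"
    and upper: "\<And>x. driven_field P a f n x \<le> K"
  shows "f z * (\<Prod>j<n. 1 + a j) \<le> real (2 * (r + n * N) + 1) ^ CARD('d) * K"
proof -
  define g where "g x = (if x = z then f z else 0)" for x
  define B where "B = (lattice_box (r + n * N) :: (int ^ 'd) set)"
  have g_sum: "(g has_sum f z) UNIV"
  proof (rule has_sum_cong_neutral[THEN iffD1])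
    show "(g has_sum f z) {z}" by (rule has_sum_finiteI) (simp_all add: g_def)
  qed (auto simp: g_def)
  have g_supp: "driven_field P a g n x = 0" if "x \<notin> B" for x
    using that z unfolding B_def by (intro driven_field_support[of r]) (auto simp: g_def)
  have "(driven_field P a g n has_sum (f z * (\<Prod>j<n. 1 + a j))) B"
    using total_mass[OF g_sum]
    by (rule has_sum_cong_neutral[THEN iffD1, rotated -1]) (auto simp: g_supp)
  then have "f z * (\<Prod>j<n. 1 + a j) = (\<Sum>x\<in>B. driven_field P a g n x)"
    by (rule has_sum_unique) (simp add: B_def)
  also have "\<dots> \<le> (\<Sum>x\<in>B. K)"
  proof (rule sum_mono)
    fix x
    have "driven_field P a g n x \<le> driven_field P a f n x"
      using a by (rule driven_field_mono) (simp add: g_def f)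
    also have "\<dots> \<le> K" by (rule upper)
    finally show "driven_field P a g n x \<le> K" .
  qed
  also have "\<dots> \<le> real (2 * (r + n * N) + 1) ^ CARD('d) * K"
  proof -
    have "0 \<le> driven_field P a f n 0" using a f by (rule driven_field_nonneg)
    then have "0 \<le> K" using upper by (rule order_trans)
    moreover have "real (card B) \<le> real ((2 * (r + n * N) + 1) ^ CARD('d))"
      unfolding B_def using card_lattice_box by (rule of_nat_mono)
    ultimately show ?thesis by (simp only: sum_constant of_nat_power mult_right_mono)
  qed
  finally show ?thesis .
qed

text \<open>The supremum is squeezed between the product \<open>\<Prod>j<n. 1 + a j\<close> divided by a polynomial and a
  constant multiple of this product. The error does not depend on the noise \<open>a\<close>, so it survives
  taking expectations.\<close>

lemma log_sup_near_log_product: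
  fixes n :: nat
  assumes a: "\<And>n. \<bar>a n\<bar> \<le> P 0 0" and lazy: "P 0 0 < 1"
    and f: "\<And>x. 0 \<le> f x" "(f has_sum s) UNIV" "0 < f z" and z: "z \<in> lattice_box r"
  defines "m \<equiv> SUP x. driven_field P a f n x"
  shows "bdd_above (range (driven_field P a f n))" and "0 < m"
    and "\<bar>ln m - (\<Sum>j<n. ln (1 + a j))\<bar>
      \<le> \<bar>ln s\<bar> + \<bar>ln (f z)\<bar> + real CARD('d) * ln (real (2 * (r + n * N) + 1))"
proof -
  define Q where "Q = (\<Prod>j<n. 1 + a j)"
  define D where "D = real (2 * (r + n * N) + 1)"
  have factor_pos: "0 < 1 + a j" for j using a[of j] lazy by linarith
  then have Q: "0 < Q" unfolding Q_def by (intro prod_pos) auto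
  have ln_Q: "ln Q = (\<Sum>j<n. ln (1 + a j))"
    unfolding Q_def by (intro ln_prod finite_lessThan) (metis factor_pos less_irrefl)
  have D: "1 \<le> D" by (simp add: D_def)
  have le_total: "driven_field P a f n x \<le> s * Q" for x
    unfolding Q_def using a f(1,2) by (rule driven_field_le_total_mass)
  then show bdd: "bdd_above (range (driven_field P a f n))" by (intro bdd_aboveI2)
  have upper: "m \<le> s * Q" unfolding m_def by (rule cSUP_least) (use le_total in auto)
  have lower: "f z * Q \<le> D ^ CARD('d) * m"
    unfolding D_def Q_def using a f(1) z
  proof (rule sup_lower_bound)
    show "driven_field P a f n x \<le> m" for x
      unfolding m_def using bdd by (rule cSUP_upper[rotated]) simp
  qed
  have Dd: "0 < D ^ CARD('d)" using D by simp
  have "0 < D ^ CARD('d) * m" using lower f(3) Q by (meson less_le_trans mult_pos_pos)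
  then show m: "0 < m" using Dd by (rule zero_less_mult_pos)
  have s: "0 < s" using upper m Q by (smt (verit) mult_nonpos_nonneg)
  have "ln m \<le> ln (s * Q)" using upper m by simp
  then have 1: "ln m \<le> ln s + ln Q" using s Q by (simp add: ln_mult)
  have "ln (f z * Q) \<le> ln (D ^ CARD('d) * m)"
    using lower mult_pos_pos[OF f(3) Q] mult_pos_pos[OF Dd m] by (simp only: ln_le_cancel_iff)
  then have 2: "ln (f z) + ln Q \<le> real CARD('d) * ln D + ln m"
    using f(3) Q m Dd D by (simp add: ln_mult ln_realpow)
  have 3: "0 \<le> real CARD('d) * ln D" using D by simp
  show "\<bar>ln m - (\<Sum>j<n. ln (1 + a j))\<bar> \<le> \<bar>ln s\<bar> + \<bar>ln (f z)\<bar>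
      + real CARD('d) * ln (real (2 * (r + n * N) + 1))"
    unfolding ln_Q[symmetric] D_def[symmetric] using 1 2 3 by linarith
qed

end

lemma log_polynomial_sublinear:
  fixes A B :: nat and K c :: real
  shows "(\<lambda>n. (K + c * ln (real (2 * (A + n * B) + 1))) / real n) \<longlonglongrightarrow> 0"
proof -
  define E where "E = ln (real (2 * (A + B) + 1))"
  have "(\<lambda>n. ln (real (2 * (A + n * B) + 1)) / real n) \<longlonglongrightarrow> 0"
  proof (rule tendsto_sandwich)
    show "\<forall>\<^sub>F n in sequentially. 0 \<le> ln (real (2 * (A + n * B) + 1)) / real n"
      by (intro always_eventually allI) simp
    show "\<forall>\<^sub>F n in sequentially. ln (real (2 * (A + n * B) + 1)) / real n \<le> (E + ln (real n)) / real n"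
      using eventually_gt_at_top[of 0]
    proof eventually_elim
      case (elim n)
      \<comment> \<open>An affine function of \<open>n \<ge> 1\<close> is at most its value at 1 times \<open>n\<close>.\<close>
      have "2 * (A + n * B) + 1 \<le> (2 * (A + B) + 1) * n"
        using elim by (cases n) (auto simp: algebra_simps)
      then have "real (2 * (A + n * B) + 1) \<le> real (2 * (A + B) + 1) * real n"
        by (metis of_nat_le_iff of_nat_mult)
      then have "ln (real (2 * (A + n * B) + 1)) \<le> ln (real (2 * (A + B) + 1) * real n)"
        using elim by (subst ln_le_cancel_iff) (auto intro!: add_pos_nonneg)
      also have "\<dots> = E + ln (real n)" using elim unfolding E_def by (subst ln_mult) auto
      finally show ?case by (rule divide_right_mono) simp
    qed
    show "(\<lambda>n. (E + ln (real n)) / real n) \<longlonglongrightarrow> 0"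
      using tendsto_add[OF lim_const_over_n[of E] lim_ln_over_n] by (simp add: add_divide_distrib)
  qed simp
  then have "(\<lambda>n. K / real n + c * (ln (real (2 * (A + n * B) + 1)) / real n)) \<longlonglongrightarrow> 0 + c * 0"
    by (intro tendsto_add tendsto_mult tendsto_const lim_const_over_n)
  then show ?thesis by (simp add: add_divide_distrib)
qed

lemma abs_ln_one_plus_le:
  fixes t c :: real
  assumes "\<bar>t\<bar> \<le> c" and "c < 1"
  shows "\<bar>ln (1 + t)\<bar> \<le> \<bar>ln (1 - c)\<bar> + \<bar>ln (1 + c)\<bar>"
proof -
  have "ln (1 - c) \<le> ln (1 + t)" "ln (1 + t) \<le> ln (1 + c)"
    using assms by (auto simp: abs_le_iff)
  then show ?thesis by linarith
qed

section \<open>The Anderson model\<close>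

text \<open>The noise obeys its bound only almost surely. Truncating it makes the bound hold everywhere
  and changes it only on a null set; the field driven by the truncated noise is then nonnegative
  and summable at every sample point, so that its supremum is a genuine random variable.\<close>

definition clamp_noise :: "real \<Rightarrow> real \<Rightarrow> real" where
  "clamp_noise c t = max (- c) (min c t)"

lemma abs_clamp_noise: "0 \<le> c \<Longrightarrow> \<bar>clamp_noise c t\<bar> \<le> c"
  by (auto simp: clamp_noise_def)

lemma clamp_noise_id: "\<bar>t\<bar> \<le> c \<Longrightarrow> clamp_noise c t = t"
  by (auto simp: clamp_noise_def)

lemma measurable_clamp_noise [measurable]: "clamp_noise c \<in> borel_measurable borel"
  unfolding clamp_noise_def by measurable

lemma (in local_walk) driven_field_measurable:
  assumes [measurable]: "\<And>n. \<zeta> n \<in> borel_measurable M"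
  shows "(\<lambda>\<omega>. driven_field P (\<lambda>j. \<zeta> j \<omega>) f n x) \<in> borel_measurable M"
proof (induction n arbitrary: x)
  case (Suc n)
  note [measurable] = Suc.IH
  show ?case unfolding driven_field_Suc tilted_mass_def by measurable
qed simp

text \<open>The equation expresses each generation explicitly by the preceding one.\<close>

lemma solution_unique_pathwise:
  assumes "\<forall>x. v 0 x = f x"
    and "\<forall>n x. v (Suc n) x - v n x = generator P (v n) x + v n x * a n"
  shows "v n = driven_field P a f n"
proof (induction n)
  case 0
  then show ?case using assms(1) by (intro ext) simp
next
  case (Suc n)
  show ?case
  proof
    fix x
    have "v (Suc n) x = transition_operator P (v n) x + a n * v n x"
      using assms(2)[rule_format, of n x] by (simp add: generator_def algebra_simps)
    then show "v (Suc n) x = driven_field P a f (Suc n) x" by (simp add: Suc.IH)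
  qed
qed

theorem theorem2p7:
  fixes M :: "'w measure"
    and \<xi> :: "nat \<Rightarrow> 'w \<Rightarrow> real"
    and P :: "int ^ 'd::finite \<Rightarrow> int ^ 'd \<Rightarrow> real"
    and u0 :: "int ^ 'd \<Rightarrow> real"
  assumes "prob_space M"
    and "iid M \<xi>"
    and "random_walk_kernel P"
    and "local_kernel P"
    and "AE \<omega> in M. \<forall>n. \<bar>\<xi> n \<omega>\<bar> \<le> P 0 0"
    and "P 0 0 < 1"
    and "\<forall>x. 0 \<le> u0 x"
    and "u0 summable_on UNIV"
    and "0 < (\<Sum>\<^sub>\<infinity>z. u0 z)"
  shows "\<exists>u. nonneg_anderson_solution M P \<xi> u0 u \<and>
      (\<forall>v. nonneg_anderson_solution M P \<xi> u0 v \<longrightarrow> (AE \<omega> in M. \<forall>n x. v n x \<omega> = u n x \<omega>)) \<and>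
      (AE \<omega> in M. \<forall>n. bdd_above (range (\<lambda>x. u n x \<omega>)) \<and> 0 < global_sup u n \<omega>) \<and>
      (\<forall>p\<ge>0.
         (\<forall>n. integrable M (\<lambda>\<omega>. global_sup u n \<omega> powr p)) \<and>
         (\<lambda>n. 1 / real n * ln (\<integral>\<omega>. global_sup u n \<omega> powr p \<partial>M))
           \<longlonglongrightarrow> Lyapunov_Gamma M \<xi> p) \<and>
      (\<exists>\<gamma>. (Lyapunov_Gamma M \<xi> has_real_derivative \<gamma>) (at_right 0) \<and>
         (AE \<omega> in M. (\<lambda>n. 1 / real n * ln (global_sup u n \<omega>)) \<longlonglongrightarrow> \<gamma>) \<and>
         (\<forall>n. integrable M (\<lambda>\<omega>. ln (global_sup u n \<omega>))) \<and>
         (\<lambda>n. 1 / real n * (\<integral>\<omega>. ln (global_sup u n \<omega>) \<partial>M)) \<longlonglongrightarrow> \<gamma>)"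
proof -
  interpret prob_space M by fact
  obtain N where "\<And>k. k \<notin> lattice_box N \<Longrightarrow> P 0 k = 0"
    using local_kernel_range assms(4) by blast
  then interpret local_walk P N using assms(3) by unfold_locales
  define c where "c = P 0 0"
  have c: "0 \<le> c" "c < 1" using P_nonneg assms(6) by (auto simp: c_def)
  have \<xi>_measurable [measurable]: "\<xi> n \<in> borel_measurable M" for n
    using assms(2) unfolding iid_def indep_vars_def by auto
  define \<zeta> where "\<zeta> n \<omega> = clamp_noise c (\<xi> n \<omega>)" for n \<omega>
  have \<zeta>_measurable [measurable]: "\<zeta> n \<in> borel_measurable M" for n
    unfolding \<zeta>_def by measurable
  have \<zeta>_bound: "\<bar>\<zeta> n \<omega>\<bar> \<le> c" for n \<omega> unfolding \<zeta>_def by (rule abs_clamp_noise) (rule c)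
  have \<zeta>_eq: "AE \<omega> in M. \<forall>n. \<zeta> n \<omega> = \<xi> n \<omega>"
    using assms(5) by eventually_elim (simp add: \<zeta>_def c_def clamp_noise_id)
  define u where "u n x \<omega> = driven_field P (\<lambda>j. \<zeta> j \<omega>) u0 n x" for n x \<omega>
  define X where "X n \<omega> = ln (1 + \<zeta> n \<omega>)" for n \<omega>

  interpret X: bounded_iid_sequence M X "\<bar>ln (1 - c)\<bar> + \<bar>ln (1 + c)\<bar>"
  proof
    have X_comp: "X n = (\<lambda>t. ln (1 + clamp_noise c t)) \<circ> \<xi> n" for n
      by (simp add: fun_eq_iff X_def \<zeta>_def)
    have "indep_vars (\<lambda>_. borel) (\<lambda>n \<omega>. ln (1 + clamp_noise c (\<xi> n \<omega>))) UNIV"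
    proof (rule indep_vars_compose2[where X = \<xi> and M' = "\<lambda>_. borel"
          and Y = "\<lambda>_ t. ln (1 + clamp_noise c t)"])
      show "indep_vars (\<lambda>_. borel) \<xi> UNIV" using assms(2) by (simp add: iid_def)
    qed measurable
    then show "indep_vars (\<lambda>_. borel) X UNIV" by (simp add: X_def[abs_def] \<zeta>_def)
    show "distr M borel (X n) = distr M borel (X 0)" for n
    proof -
      have "distr M borel (X m) = distr (distr M borel (\<xi> m)) borel (\<lambda>t. ln (1 + clamp_noise c t))" for m
        unfolding X_comp by (rule distr_distr[symmetric]) auto
      then show ?thesis using assms(2) unfolding iid_def by metis
    qed
    show "\<bar>X n \<omega>\<bar> \<le> \<bar>ln (1 - c)\<bar> + \<bar>ln (1 + c)\<bar>" for n \<omega>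
      unfolding X_def using \<zeta>_bound c(2) by (rule abs_ln_one_plus_le)
  qed

  define S where "S = (\<Sum>\<^sub>\<infinity>z. u0 z)"
  have S: "(u0 has_sum S) UNIV" unfolding S_def using assms(8) by simp
  have "\<exists>z. u0 z \<noteq> 0"
    using assms(9) by (metis infsum_0 less_irrefl)
  then obtain z where z: "0 < u0 z" using assms(7) by (metis order_less_le)
  obtain r where r: "z \<in> lattice_box r" using ex_lattice_box by blast
  define b where "b n = (\<bar>ln S\<bar> + \<bar>ln (u0 z)\<bar>) + real CARD('d) * ln (real (2 * (r + n * N) + 1))" for n
  \<comment> \<open>Everything asymptotic concerns \<open>Z\<close>, a deterministic \<open>o(n)\<close> away from the i.i.d. sum of the \<open>X j\<close>.\<close>
  define Z where "Z n \<omega> = ln (global_sup u n \<omega>)" for n \<omega>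

  note sup_facts = log_sup_near_log_product[OF \<zeta>_bound[unfolded c_def] assms(6)
      assms(7)[rule_format] S z r]
  have bdd: "bdd_above (range (\<lambda>x. u n x \<omega>))" for n \<omega>
    unfolding u_def by (rule sup_facts(1))
  have sup_pos: "0 < global_sup u n \<omega>" for n \<omega>
    unfolding global_sup_def u_def by (rule sup_facts(2))
  have near: "\<bar>Z n \<omega> - (\<Sum>j<n. X j \<omega>)\<bar> \<le> b n" for n \<omega>
    unfolding Z_def global_sup_def u_def b_def X_def by (rule sup_facts(3))
  have sublinear: "(\<lambda>n. b n / real n) \<longlonglongrightarrow> 0"
    unfolding b_def by (rule log_polynomial_sublinear)
  have u_measurable [measurable]: "u n x \<in> borel_measurable M" for n x
    unfolding u_def by (rule driven_field_measurable) measurable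
  have Z_measurable: "Z n \<in> borel_measurable M" for n
  proof -
    have "(\<lambda>\<omega>. SUP x. u n x \<omega>) \<in> borel_measurable M"
      by (rule borel_measurable_cSUP) (auto intro: bdd)
    then show ?thesis unfolding Z_def global_sup_def by measurable
  qed
  note growth_facts = Z_measurable near sublinear
  have powr_sup: "global_sup u n \<omega> powr p = exp (p * Z n \<omega>)" for n \<omega> p
    using sup_pos[of n \<omega>] by (simp add: powr_def Z_def)

  have Gamma: "Lyapunov_Gamma M \<xi> = (\<lambda>p. ln (expectation (\<lambda>\<omega>. exp (p * X 0 \<omega>))))"
  proof
    fix p
    have "expectation (\<lambda>\<omega>. (1 + \<xi> 1 \<omega>) powr p) = expectation (\<lambda>\<omega>. exp (p * X 1 \<omega>))"
    proof (rule integral_cong_AE)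
      show "AE \<omega> in M. (1 + \<xi> 1 \<omega>) powr p = exp (p * X 1 \<omega>)"
        using \<zeta>_eq
      proof eventually_elim
        case (elim \<omega>)
        have "0 < 1 + \<zeta> 1 \<omega>" using \<zeta>_bound[of 1 \<omega>] c by linarith
        then show ?case using elim by (simp add: X_def powr_def)
      qed
    qed measurable
    also have "\<dots> = expectation (\<lambda>\<omega>. exp (p * X 0 \<omega>))"
      by (rule X.expectation_comp_X) measurable
    finally show "Lyapunov_Gamma M \<xi> p = ln (expectation (\<lambda>\<omega>. exp (p * X 0 \<omega>)))"
      by (simp add: Lyapunov_Gamma_def)
  qed
  have Gamma': "(Lyapunov_Gamma M \<xi> has_real_derivative expectation (X 0)) (at_right 0)"
  proof -
    have "((\<lambda>p. expectation (\<lambda>\<omega>. exp (p * X 0 \<omega>))) has_real_derivative expectation (X 0)) (at 0)"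
      using X.bounded by (rule exponential_moment_has_derivative[rotated]) measurable
    then have "((\<lambda>p. ln (expectation (\<lambda>\<omega>. exp (p * X 0 \<omega>)))) has_real_derivative expectation (X 0)) (at 0)"
      by (auto intro!: derivative_eq_intros simp: prob_space)
    then show ?thesis unfolding Gamma by (rule has_field_derivative_at_within)
  qed

  have solution: "nonneg_anderson_solution M P \<xi> u0 u"
    unfolding nonneg_anderson_solution_def anderson_solution_def
  proof (intro conjI allI u_measurable)
    show "AE \<omega> in M. \<forall>x. u 0 x \<omega> = u0 x" by (simp add: u_def)
    show "AE \<omega> in M. \<forall>n x. u (Suc n) x \<omega> - u n x \<omega>
        = generator P (\<lambda>y. u n y \<omega>) x + u n x \<omega> * \<xi> n \<omega>"
      using \<zeta>_eq by eventually_elim (simp add: u_def generator_def)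
    show "AE \<omega> in M. \<forall>n x. 0 \<le> u n x \<omega>"
      unfolding u_def using \<zeta>_bound assms(7)
      by (intro AE_I2 allI driven_field_nonneg) (auto simp: c_def)
  qed
  have unique: "AE \<omega> in M. \<forall>n x. v n x \<omega> = u n x \<omega>"
    if v: "nonneg_anderson_solution M P \<xi> u0 v" for v
  proof -
    have "AE \<omega> in M. \<forall>x. v 0 x \<omega> = u0 x"
      and "AE \<omega> in M. \<forall>n x. v (Suc n) x \<omega> - v n x \<omega>
        = generator P (\<lambda>y. v n y \<omega>) x + v n x \<omega> * \<xi> n \<omega>"
      using v unfolding nonneg_anderson_solution_def anderson_solution_def by auto
    then show ?thesis
      using \<zeta>_eq
    proof eventually_elim
      case (elim \<omega>)
      then have "(\<lambda>x. v n x \<omega>) = driven_field P (\<lambda>j. \<zeta> j \<omega>) u0 n" for n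
        by (intro solution_unique_pathwise[where v = "\<lambda>n x. v n x \<omega>"]) auto
      then show ?case unfolding u_def by (metis (mono_tags))
    qed
  qed

  show ?thesis
  proof (intro exI[of _ u] conjI allI impI exI[of _ "expectation (X 0)"])
    show "AE \<omega> in M. \<forall>n. bdd_above (range (\<lambda>x. u n x \<omega>)) \<and> 0 < global_sup u n \<omega>"
      using bdd sup_pos by simp
    show "integrable M (\<lambda>\<omega>. global_sup u n \<omega> powr p)" for n p
      unfolding powr_sup by (rule X.integrable_exp_near[OF growth_facts])
    show "(\<lambda>n. 1 / real n * ln (\<integral>\<omega>. global_sup u n \<omega> powr p \<partial>M)) \<longlonglongrightarrow> Lyapunov_Gamma M \<xi> p" for p
      unfolding powr_sup Gamma by (rule X.growth_rate_moment[OF growth_facts])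
    show "AE \<omega> in M. (\<lambda>n. 1 / real n * ln (global_sup u n \<omega>)) \<longlonglongrightarrow> expectation (X 0)"
      using X.growth_rate_almost_surely[OF growth_facts] unfolding Z_def .
    show "integrable M (\<lambda>\<omega>. ln (global_sup u n \<omega>))" for n
      using X.integrable_near[OF growth_facts] unfolding Z_def .
    show "(\<lambda>n. 1 / real n * (\<integral>\<omega>. ln (global_sup u n \<omega>) \<partial>M)) \<longlonglongrightarrow> expectation (X 0)"
      using X.growth_rate_mean[OF growth_facts] unfolding Z_def .
  qed (use solution unique Gamma' in auto)
qed

end
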